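(* Let $k\ge 2$ be an integer and let $\mathcal{A}\subseteq [2k]^{(k)}\cup [2k]^{(k+1)}\cup [2k]^{(k+2)}$ be an intersecting temperate collection of sets. Then $$|\mathcal{A}|\le \frac12\binom{2k}{k}+\binom{2k}{k+1}+\binom{2k-1}{k+2}.$$
   Context: For a positive integer $n$, $[n]=\{1,2,\ldots,n\}$ and $[n]^{(i)}=\{A\subseteq [n]:|A|=i\}$ (empty if $i>n$). A collection $\mathcal{A}$ of subsets of $[n]$ is called temperate if for every $A\in\mathcal{A}$ there are at most $|A|$ proper subsets of $A$ belonging to $\mathcal{A}$. It is called intersecting if $A\cap B\neq\emptyset$ for all $A,B\in\mathcal{A}$. Binomial coefficients $\binom{m}{i}$ with $i>m\ge 0$ are $0$. *)

theory Defs
  imports Complex_Main "HOL-Library.Ramsey"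
begin

(* Intended for collections of finite sets: only then does card count
   the proper subsets of each member. *)
definition temperate :: "'a set set \<Rightarrow> bool" where
  "temperate \<A> \<longleftrightarrow> (\<forall>A\<in>\<A>. card {B \<in> \<A>. B \<subset> A} \<le> card A)"

(* A = B is allowed, so the empty set is never a member. *)
definition intersecting :: "'a set set \<Rightarrow> bool" where
  "intersecting \<A> \<longleftrightarrow> (\<forall>A\<in>\<A>. \<forall>B\<in>\<A>. A \<inter> B \<noteq> {})"

end

theory Submission
  imports Defs "HOL-Combinatorics.Multiset_Permutations"
begin

text \<open>
  Katona's circle method with an error term. Let \<open>F\<close> and \<open>G\<close> be the members of size \<open>k\<close> and
  \<open>k + 2\<close>, and \<open>m\<close> the number of \<open>(k + 1)\<close>-sets that are not members. On a circular order of the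
  \<open>2k\<close> points, at most \<open>k\<close> arcs of length \<open>k\<close> lie in \<open>F\<close>. If \<open>a > 0\<close> of them do, then at least
  \<open>a + 2\<close> arcs of length \<open>k + 2\<close> contain one of these, so the number of \<open>(k + 2)\<close>-arcs in \<open>G\<close> is at
  most \<open>2k - 2 - a\<close> plus the number of nested pairs of arcs from \<open>F\<close> and \<open>G\<close>. Averaging over all
  circular orders bounds \<open>|F| + |G|\<close> by the desired value plus
  \<open>6P / ((k + 1)(k + 2))\<close>, where \<open>P\<close> counts the pairs \<open>K \<subset> B\<close> with \<open>K \<in> F\<close>, \<open>B \<in> G\<close>.
  Temperateness says that \<open>B\<close> contains at most as many \<open>K \<in> F\<close> as missing \<open>(k + 1)\<close>-sets, whence
  \<open>P \<le> (k - 1) m\<close>, and the error term is at most \<open>m\<close>.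
\<close>

section \<open>Counting orderings by the sets on their arcs\<close>

text \<open>An ordering with prefix set \<open>B\<close> is the same as an ordering of
  \<open>B\<close> followed by one of \<open>X - B\<close>. The predicate \<open>Q\<close> is there
  so that conditions on the order inside the prefix, such as an inner arc, can be counted
  too.\<close>

lemma card_permutations_prefix:
  assumes "finite X" and G: "\<And>B. B \<in> G \<Longrightarrow> B \<subseteq> X \<and> card B = s"
  shows "card {xs \<in> permutations_of_set X. set (take s xs) \<in> G \<and> Q (take s xs)}
       = (\<Sum>B\<in>G. card {ys \<in> permutations_of_set B. Q ys}) * fact (card X - s)"
proof -
  let ?T = "SIGMA B:G. {ys \<in> permutations_of_set B. Q ys} \<times> permutations_of_set (X - B)"
  let ?R = "{xs \<in> permutations_of_set X. set (take s xs) \<in> G \<and> Q (take s xs)}"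
  have finG: "finite G"
    using assms by (auto intro!: finite_subset[of G "Pow X"])
  have fin: "finite B" if "B \<in> G" for B
    using that assms by (meson finite_subset)
  have len: "length ys = s" if "B \<in> G" "ys \<in> permutations_of_set B" for B ys
    using that G by (auto simp: permutations_of_set_def distinct_card[symmetric])
  have "bij_betw (\<lambda>(B, ys, zs). ys @ zs) ?T ?R"
  proof (rule bij_betw_byWitness[where f' = "\<lambda>xs. (set (take s xs), take s xs, drop s xs)"])
    show "\<forall>p\<in>?T. (\<lambda>xs. (set (take s xs), take s xs, drop s xs)) (case p of (B, ys, zs) \<Rightarrow> ys @ zs) = p"
      using len by (auto dest: permutations_of_setD)
    show "\<forall>xs\<in>?R. (case (set (take s xs), take s xs, drop s xs) of (B, ys, zs) \<Rightarrow> ys @ zs) = xs"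
      by simp
    show "(\<lambda>(B, ys, zs). ys @ zs) ` ?T \<subseteq> ?R"
      using len G by (auto simp: permutations_of_set_def) blast+
    show "(\<lambda>xs. (set (take s xs), take s xs, drop s xs)) ` ?R \<subseteq> ?T"
    proof (clarsimp simp: permutations_of_set_def)
      fix xs :: "'a list" assume "distinct xs"
      then show "set (drop s xs) = set xs - set (take s xs)"
        by (metis Diff_cancel Diff_disjoint Un_Diff append_take_drop_id distinct_append set_append
            Diff_triv Int_commute Un_empty_left sup_bot_left)
    qed
  qed
  then have "card ?R = card ?T"
    by (simp add: bij_betw_same_card)
  also have "\<dots> = (\<Sum>B\<in>G. card {ys \<in> permutations_of_set B. Q ys} * fact (card X - s))"
  proof (subst card_SigmaI)
    show "(\<Sum>B\<in>G. card ({ys \<in> permutations_of_set B. Q ys} \<times> permutations_of_set (X - B)))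
        = (\<Sum>B\<in>G. card {ys \<in> permutations_of_set B. Q ys} * fact (card X - s))"
      using G fin by (intro sum.cong) (simp_all add: card_cartesian_product card_Diff_subset assms(1))
  qed (use assms finG in auto)
  finally show ?thesis by (simp add: sum_distrib_right)
qed

lemma bij_betw_rotate_permutations:
  "bij_betw (rotate i) (permutations_of_set X) (permutations_of_set X)"
proof -
  have "inj (rotate i)"
    unfolding rotate_def by (rule inj_fn[OF inj_rotate1])
  then show ?thesis
    by (intro bij_betw_imageI endo_inj_surj)
      (auto simp: permutations_of_set_def intro: inj_on_subset finite_permutations_of_set[unfolded permutations_of_set_def])
qed

text \<open>Rotation permutes the orderings, so every arc may be assumed to start at position
  0.\<close>

lemma card_permutations_rotate:
  "card {xs \<in> permutations_of_set X. P (rotate i xs)} = card {xs \<in> permutations_of_set X. P xs}"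
proof -
  have "rotate i ` {xs \<in> S. P (rotate i xs)} = {xs \<in> rotate i ` S. P xs}" for S
    by auto
  from this[of "permutations_of_set X"]
  have "rotate i ` {xs \<in> permutations_of_set X. P (rotate i xs)} = {xs \<in> permutations_of_set X. P xs}"
    by (simp only: bij_betw_imp_surj_on[OF bij_betw_rotate_permutations])
  then show ?thesis
    by (intro bij_betw_same_card[OF bij_betw_subset[OF bij_betw_rotate_permutations]]) auto
qed

lemma card_permutations_arc:
  assumes "finite X" and "\<And>B. B \<in> G \<Longrightarrow> B \<subseteq> X \<and> card B = s"
  shows "card {xs \<in> permutations_of_set X. set (take s (rotate i xs)) \<in> G}
       = card G * fact s * fact (card X - s)"
proof -
  have "card {xs \<in> permutations_of_set X. set (take s (rotate i xs)) \<in> G}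
      = card {xs \<in> permutations_of_set X. set (take s xs) \<in> G \<and> True}"
    using card_permutations_rotate[of X "\<lambda>xs. set (take s xs) \<in> G" i] by simp
  also have "\<dots> = (\<Sum>B\<in>G. card {ys \<in> permutations_of_set B. True}) * fact (card X - s)"
    by (rule card_permutations_prefix[OF assms])
  also have "(\<Sum>B\<in>G. card {ys \<in> permutations_of_set B. True}) = (\<Sum>B\<in>G. fact s)"
    using assms by (intro sum.cong) (auto simp: finite_subset[of _ X])
  finally show ?thesis by simp
qed

text \<open>Since \<open>j + s \<le> t\<close>, the inner arc lies within the outer one without
  wrapping around and depends only on the ordering of the outer arc. So the count for single arcs
  applies a second time, with each \<open>B\<close> in \<open>G\<close> as ground set, and the
  result is independent of \<open>i\<close> and \<open>j\<close>.\<close>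

lemma card_permutations_nested_arcs:
  assumes "finite X" and G: "\<And>B. B \<in> G \<Longrightarrow> B \<subseteq> X \<and> card B = t"
    and F: "\<And>B. B \<in> F \<Longrightarrow> B \<subseteq> X \<and> card B = s" and "j + s \<le> t" and "t \<le> card X"
  shows "card {xs \<in> permutations_of_set X.
            set (take t (rotate i xs)) \<in> G \<and> set (take s (rotate (i + j) xs)) \<in> F}
       = (\<Sum>B\<in>G. card {K \<in> F. K \<subseteq> B}) * fact s * fact (t - s) * fact (card X - t)"
proof -
  have arc: "set (take s (rotate (i + j) xs)) = set (take s (rotate j (take t (rotate i xs))))"
    if "xs \<in> permutations_of_set X" for xs
  proof -
    have l: "length xs = card X"
      using that by (auto simp: permutations_of_set_def distinct_card[symmetric])
    \<comment> \<open>Rotation reduces \<open>j\<close> modulo the length. The boundary case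
      \<open>j = length ys\<close> forces \<open>s = 0\<close>, where both sides are empty.\<close>
    have *: "take s (rotate j ys) = take s (drop j ys)" if "j + s \<le> length ys" for ys :: "'a list"
      using that by (cases "j = length ys") (auto simp: rotate_drop_take)
    have "rotate (i + j) xs = rotate j (rotate i xs)"
      by (simp add: rotate_rotate add.commute)
    then show ?thesis
      using assms(4,5) l by (simp add: * drop_take take_take min_def)
  qed
  have "card {xs \<in> permutations_of_set X.
            set (take t (rotate i xs)) \<in> G \<and> set (take s (rotate (i + j) xs)) \<in> F}
      = card {xs \<in> permutations_of_set X.
            set (take t (rotate i xs)) \<in> G \<and> set (take s (rotate j (take t (rotate i xs)))) \<in> F}"
    using arc by (intro arg_cong[where f = card]) auto
  also have "\<dots> = card {xs \<in> permutations_of_set X.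
            set (take t xs) \<in> G \<and> set (take s (rotate j (take t xs))) \<in> F}"
    by (rule card_permutations_rotate[where P = "\<lambda>xs. set (take t xs) \<in> G \<and> set (take s (rotate j (take t xs))) \<in> F"])
  also have "\<dots> = (\<Sum>B\<in>G. card {ys \<in> permutations_of_set B. set (take s (rotate j ys)) \<in> F})
        * fact (card X - t)"
    by (rule card_permutations_prefix[OF assms(1) G])
  also have "(\<Sum>B\<in>G. card {ys \<in> permutations_of_set B. set (take s (rotate j ys)) \<in> F})
      = (\<Sum>B\<in>G. card {K \<in> F. K \<subseteq> B} * fact s * fact (t - s))"
  proof (rule sum.cong)
    fix B assume B: "B \<in> G"
    have "{ys \<in> permutations_of_set B. set (take s (rotate j ys)) \<in> F}
        = {ys \<in> permutations_of_set B. set (take s (rotate j ys)) \<in> {K \<in> F. K \<subseteq> B}}"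
      by (auto simp: permutations_of_set_def dest: in_set_takeD)
    then show "card {ys \<in> permutations_of_set B. set (take s (rotate j ys)) \<in> F}
        = card {K \<in> F. K \<subseteq> B} * fact s * fact (t - s)"
      using card_permutations_arc[of B "{K \<in> F. K \<subseteq> B}" s j] B G[OF B] F
      by (auto simp: finite_subset[OF _ assms(1)])
  qed simp
  finally show ?thesis by (simp add: sum_distrib_right)
qed

section \<open>Arc patterns on a single circle\<close>

text \<open>A nonempty set of positions closed under cyclic predecessors is the whole circle, so for
  a smaller \<open>T\<close> adding all predecessors gains a point.\<close>

lemma card_cyclic_shift_ge:
  fixes T :: "nat set"
  assumes T: "T \<subseteq> {..<n}" "T \<noteq> {}" and "card T < n"
  shows "card T + 1 \<le> card {i \<in> {..<n}. i \<in> T \<or> Suc i mod n \<in> T}"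
proof -
  let ?D = "{i \<in> {..<n}. i \<in> T \<or> Suc i mod n \<in> T}"
  have "T \<noteq> ?D"
  proof
    assume eq: "T = ?D"
    have closed: "i \<in> T" if "i < n" "Suc i mod n \<in> T" for i
      using that eq by blast
    from T obtain t where t: "t \<in> T" "t < n" by auto
    have down: "t - d \<in> T" for d
    proof (induction d)
      case (Suc d)
      show ?case
      proof (cases "t \<le> d")
        case False
        then have "Suc (t - Suc d) mod n = t - d" using t by (simp add: Suc_diff_Suc)
        with Suc show ?thesis using closed[of "t - Suc d"] t by simp
      qed (use Suc in auto)
    qed (use t in simp)
    \<comment> \<open>Descending from \<open>t\<close> reaches 0, whose predecessor is
      \<open>n - 1\<close>; descending from there covers the circle.\<close>
    have "n - Suc d \<in> T" if "d < n" for d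
      using that
    proof (induction d)
      case 0
      then show ?case using closed[of "n - 1"] down[of t] by simp
    next
      case (Suc d)
      then have "Suc (n - Suc (Suc d)) mod n = n - Suc d" by (simp add: Suc_diff_Suc)
      with Suc show ?case using closed[of "n - Suc (Suc d)"] by simp
    qed
    then have "i \<in> T" if "i < n" for i
      using that by (metis Suc_diff_Suc diff_diff_cancel less_imp_le_nat
          diff_Suc_less gr_implies_not0 not_gr_zero)
    then have "T = {..<n}" using T by auto
    with assms show False by simp
  qed
  then have "T \<subset> ?D" using T by auto
  then have "card T < card ?D" by (intro psubset_card_mono) auto
  then show ?thesis by simp
qed

lemma card_cyclic_shift2_ge:
  fixes S :: "nat set"
  assumes S: "S \<subseteq> {..<n}" "S \<noteq> {}" and "card S + 2 \<le> n"
  shows "card S + 2 \<le> card {i \<in> {..<n}. \<exists>j\<le>2. (i + j) mod n \<in> S}"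
proof -
  let ?D = "\<lambda>T. {i \<in> {..<n}. i \<in> T \<or> Suc i mod n \<in> T}"
  have sub: "?D (?D S) \<subseteq> {i \<in> {..<n}. \<exists>j\<le>2. (i + j) mod n \<in> S}" (is "_ \<subseteq> ?R")
  proof
    fix i assume i: "i \<in> ?D (?D S)"
    then have "i \<in> S \<or> Suc i mod n \<in> S \<or> Suc (Suc i) mod n \<in> S" "i < n"
      by (auto simp: mod_Suc_eq)
    then have "(i + 0) mod n \<in> S \<or> (i + 1) mod n \<in> S \<or> (i + 2) mod n \<in> S" by simp
    with \<open>i < n\<close> show "i \<in> ?R" by (auto intro: exI[of _ 0] exI[of _ 1] exI[of _ 2])
  qed
  have 1: "card S + 1 \<le> card (?D S)"
    using assms by (intro card_cyclic_shift_ge) auto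
  have "?D S \<noteq> {}" using S by auto
  have "card S + 2 \<le> card (?D (?D S))"
  proof (cases "card (?D S) < n")
    case True
    then have "card (?D S) + 1 \<le> card (?D (?D S))"
      using \<open>?D S \<noteq> {}\<close> by (intro card_cyclic_shift_ge) auto
    with 1 show ?thesis by simp
  next
    case False
    \<comment> \<open>If one step already fills the circle, the gain of 2 comes from
      \<open>card S + 2 \<le> n\<close> instead. In the application this reads
      \<open>k + 2 \<le> 2 * k\<close>.\<close>
    have "card (?D S) \<le> card (?D (?D S))" by (intro card_mono) auto
    with False assms show ?thesis by simp
  qed
  also have "\<dots> \<le> card ?R" using sub by (intro card_mono) auto
  finally show ?thesis .
qed

text \<open>Here \<open>p\<close> and \<open>q\<close> mark the starts of arcs in \<open>F\<close>
  and \<open>G\<close>; a \<open>(k + 2)\<close>-arc from \<open>i\<close> contains the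
  \<open>k\<close>-arcs from \<open>i\<close>, \<open>i + 1\<close>, \<open>i + 2\<close>. Let a, b,
  e be the three cardinalities. If a > 0, then b <= 2k - 2 - a + e, so the left side is at most (u -
  v) a + (2k - 2) v + v e. As \<open>v \<le> u\<close>, this is largest at a = k, which gives the
  claim. If a = 0, only b <= 2k is known, and the last assumption on \<open>v\<close> is exactly
  what makes this suffice.\<close>

lemma cyclic_pattern_bound:
  fixes p q :: "nat \<Rightarrow> bool" and u v :: real
  assumes "k \<ge> 2" and per: "\<And>i. p (i mod (2 * k)) \<longleftrightarrow> p i"
    and opp: "\<And>i. \<not> (p i \<and> p (i + k))"
    and v: "0 \<le> v" "v \<le> u" "(real k + 2) * v \<le> real k * u"
  shows "u * card {i \<in> {..<2 * k}. p i} + v * card {i \<in> {..<2 * k}. q i}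
       \<le> real k * u + (real k - 2) * v
         + v * card {(i, j) \<in> {..<2 * k} \<times> {..2}. q i \<and> p (i + j)}"
proof -
  let ?n = "2 * k"
  let ?S = "{i \<in> {..<?n}. p i}" and ?T = "{i \<in> {..<?n}. q i}"
  let ?U = "{i \<in> {..<?n}. \<exists>j\<le>2. p (i + j)}"
  let ?E = "{(i, j) \<in> {..<?n} \<times> {..2}. q i \<and> p (i + j)}"
  have finE: "finite ?E"
    by (rule finite_subset[of _ "{..<?n} \<times> {..2}"]) auto
  \<comment> \<open>Opposite arcs are complementary, so at most one of each pair is in the family.\<close>
  have S_le: "card ?S \<le> k"
  proof -
    have "inj_on (\<lambda>i. i mod k) ?S"
    proof (rule inj_onI)
      fix i i' assume i: "i \<in> ?S" "i' \<in> ?S" "i mod k = i' mod k"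
      have "i div k < 2" "i' div k < 2"
        using i by (auto simp: less_mult_imp_div_less)
      then have "i = i mod k \<or> i = k + i mod k" "i' = i' mod k \<or> i' = k + i' mod k"
        using div_mult_mod_eq[of i k] div_mult_mod_eq[of i' k]
        by (auto simp only: less_2_cases_iff mult_0 mult_1 add_0 One_nat_def[symmetric])
      then have "i = i' \<or> i = i' + k \<or> i' = i + k"
        using i(3) by linarith
      then show "i = i'" using i opp[of i] opp[of i'] by auto
    qed
    then have "card ?S \<le> card {..<k}"
      by (rule card_inj_on_le) (use \<open>k \<ge> 2\<close> in auto)
    then show ?thesis by simp
  qed
  have T_le: "card ?T \<le> ?n"
    using card_mono[of "{..<?n}" ?T] by auto
  show ?thesis
  proof (cases "?S = {}")
    case True
    have "v * card ?T \<le> v * real (2 * k)"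
      using T_le v by (intro mult_left_mono) auto
    also have "\<dots> \<le> real k * u + (real k - 2) * v"
      using v by (simp add: algebra_simps)
    also have "\<dots> \<le> \<dots> + v * card ?E" using v by simp
    finally show ?thesis unfolding True by simp
  next
    case False
    have "{i \<in> {..<?n}. \<exists>j\<le>2. (i + j) mod ?n \<in> ?S} = ?U"
      using \<open>k \<ge> 2\<close> by (auto simp: per)
    then have U_ge: "card ?S + 2 \<le> card ?U"
      using card_cyclic_shift2_ge[of ?S ?n] False S_le \<open>k \<ge> 2\<close> by auto
    have "card ?T + card ?U = card (?T \<union> ?U) + card (?T \<inter> ?U)"
      by (intro card_Un_Int) auto
    moreover have "card (?T \<union> ?U) \<le> card {..<?n}"
      by (intro card_mono) auto
    \<comment> \<open>Each position in both sets is the first coordinate of some nested pair in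
      \<open>?E\<close>.\<close>
    moreover have "card (?T \<inter> ?U) \<le> card (fst ` ?E)"
      using finE by (intro card_mono) (fastforce simp: image_iff)+
    moreover have "card (fst ` ?E) \<le> card ?E"
      using finE by (rule card_image_le)
    ultimately have "card ?T + card ?S + 2 \<le> 2 * k + card ?E"
      using U_ge by simp
    then have "real (card ?T) + card ?S + 2 \<le> 2 * k + card ?E"
      by (metis (mono_tags) of_nat_add of_nat_le_iff of_nat_numeral)
    then have "v * card ?T \<le> v * (2 * real k + card ?E - card ?S - 2)"
      using v by (intro mult_left_mono) auto
    moreover have "0 \<le> (u - v) * (real k - card ?S)"
      using v S_le by simp
    ultimately show ?thesis by (simp add: algebra_simps)
  qed
qed

text \<open>
  The index \<open>i\<close> below is the starting position of an arc on the circle. Counting positions rather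
  than sets keeps the case \<open>k = 2\<close> uniform, where all arcs of length \<open>k + 2\<close> are the same set.
\<close>
lemma circle_bound:
  fixes u v :: real
  assumes "k \<ge> 2" and xs: "length xs = 2 * k" "distinct xs"
    and F: "\<And>A B. A \<in> F \<Longrightarrow> B \<in> F \<Longrightarrow> A \<inter> B \<noteq> {}"
    and v: "0 \<le> v" "v \<le> u" "(real k + 2) * v \<le> real k * u"
  shows "u * card {i \<in> {..<2 * k}. set (take k (rotate i xs)) \<in> F}
         + v * card {i \<in> {..<2 * k}. set (take (k + 2) (rotate i xs)) \<in> G}
       \<le> real k * u + (real k - 2) * v
         + v * card {(i, j) \<in> {..<2 * k} \<times> {..2}.
             set (take (k + 2) (rotate i xs)) \<in> G \<and> set (take k (rotate (i + j) xs)) \<in> F}"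
proof (rule cyclic_pattern_bound[OF \<open>k \<ge> 2\<close> _ _ v])
  show "set (take k (rotate (i mod (2 * k)) xs)) \<in> F \<longleftrightarrow> set (take k (rotate i xs)) \<in> F" for i
    using rotate_conv_mod[of i xs] xs by simp
  show "\<not> (set (take k (rotate i xs)) \<in> F \<and> set (take k (rotate (i + k) xs)) \<in> F)" for i
  proof -
    have "take k (rotate (i + k) xs) = take k (rotate k (rotate i xs))"
      by (simp add: rotate_rotate add.commute)
    also have "\<dots> = drop k (rotate i xs)"
      using xs \<open>k \<ge> 2\<close> by (simp add: rotate_drop_take)
    finally have "set (take k (rotate i xs)) \<inter> set (take k (rotate (i + k) xs)) = {}"
      using xs by (simp add: set_take_disj_set_drop_if_distinct)
    then show ?thesis using F by blast
  qed
qed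

section \<open>Binomial weights and averaging over all orderings\<close>

text \<open>Both binomials times their factorials give \<open>fact (2 * k)\<close>. The resulting
  ratio supplies the inequalities between the weights that the circle bound demands.\<close>

lemma central_binomial_shift2:
  assumes "k \<ge> 2"
  shows "(k + 1) * (k + 2) * ((2 * k) choose (k + 2)) = k * (k - 1) * ((2 * k) choose k)"
proof -
  obtain l where "k = Suc (Suc l)"
    using assms by (metis add_2_eq_Suc le_Suc_ex)
  then have fact_k: "fact k = k * (k - 1) * fact (k - 2)"
    by (simp add: algebra_simps)
  have fact_k2: "fact (k + 2) = (k + 2) * (k + 1) * fact k"
    by (simp add: algebra_simps)
  have "fact k * fact (2 * k - k) * ((2 * k) choose k) = (fact (2 * k) :: nat)"
    by (rule binomial_fact_lemma) simp
  moreover have "fact (k + 2) * fact (2 * k - (k + 2)) * ((2 * k) choose (k + 2)) = (fact (2 * k) :: nat)"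
    by (rule binomial_fact_lemma) (use assms in simp)
  moreover have "2 * k - k = k" "2 * k - (k + 2) = k - 2" by simp_all
  ultimately have "fact (k + 2) * fact (k - 2) * ((2 * k) choose (k + 2)) = fact k * fact k * ((2 * k) choose k)"
    by simp
  then have "fact k * fact (k - 2) * ((k + 1) * (k + 2) * ((2 * k) choose (k + 2)))
      = fact k * (k * (k - 1) * fact (k - 2)) * ((2 * k) choose k)"
    unfolding fact_k2 fact_k[symmetric] by (simp only: mult_ac)
  also have "\<dots> = fact k * fact (k - 2) * (k * (k - 1) * ((2 * k) choose k))"
    by (simp only: mult_ac)
  finally show ?thesis by simp
qed

lemma two_layer_bound:
  assumes "k \<ge> 2" "finite X" "card X = 2 * k"
    and F: "F \<subseteq> nsets X k" and G: "G \<subseteq> nsets X (k + 2)"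
    and int: "\<And>A B. A \<in> F \<Longrightarrow> B \<in> F \<Longrightarrow> A \<inter> B \<noteq> {}"
  shows "2 * real k * (card F + card G)
       \<le> real k * ((2 * k) choose k) + (real k - 2) * ((2 * k) choose (k + 2))
         + 12 * real k * (\<Sum>B\<in>G. card {K \<in> F. K \<subseteq> B}) / ((real k + 1) * (real k + 2))"
proof -
  let ?L = "permutations_of_set X"
  \<comment> \<open>A given \<open>k\<close>-set fills a given arc in k! k! orderings, a given
    \<open>(k + 2)\<close>-set in (k + 2)! (k - 2)!. The weights \<open>u\<close> and
    \<open>v\<close> turn both numbers into \<open>N\<close>, so that members of \<open>F\<close>
    and \<open>G\<close> count equally.\<close>
  define u where "u = real ((2 * k) choose k)"
  define v where "v = real ((2 * k) choose (k + 2))"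
  define P where "P = (\<Sum>B\<in>G. card {K \<in> F. K \<subseteq> B})"
  define N where "N = (fact (2 * k) :: real)"
  define e where "e xs = card {(i, j) \<in> {..<2 * k} \<times> {..2::nat}.
      set (take (k + 2) (rotate i xs)) \<in> G \<and> set (take k (rotate (i + j) xs)) \<in> F}" for xs
  define a where "a xs = card {i \<in> {..<2 * k}. set (take k (rotate i xs)) \<in> F}" for xs
  define b where "b xs = card {i \<in> {..<2 * k}. set (take (k + 2) (rotate i xs)) \<in> G}" for xs
  have FX: "B \<subseteq> X \<and> card B = k" if "B \<in> F" for B using F that by (auto simp: nsets_def)
  have GX: "B \<subseteq> X \<and> card B = k + 2" if "B \<in> G" for B using G that by (auto simp: nsets_def)
  have "real ((k + 1) * (k + 2) * ((2 * k) choose (k + 2))) = real (k * (k - 1) * ((2 * k) choose k))"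
    by (simp only: central_binomial_shift2[OF \<open>k \<ge> 2\<close>])
  then have uv: "(real k + 1) * (real k + 2) * v = real k * (real k - 1) * u"
    using \<open>k \<ge> 2\<close> by (simp add: u_def v_def of_nat_diff algebra_simps)
  have u0: "0 \<le> u" and v0: "0 \<le> v" by (simp_all add: u_def v_def)
  have "real k * (real k - 1) * u \<le> (real k + 1) * (real k * u)"
    using u0 by (simp add: algebra_simps)
  then have "(real k + 1) * ((real k + 2) * v) \<le> (real k + 1) * (real k * u)"
    using uv by (simp only: mult.assoc)
  then have v1: "(real k + 2) * v \<le> real k * u"
    by (subst (asm) mult_le_cancel_left_pos) auto
  have "real k * (real k - 1) * u \<le> (real k + 1) * (real k + 2) * u"
    using u0 by (intro mult_right_mono) (auto simp: algebra_simps)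
  then have "(real k + 1) * (real k + 2) * v \<le> (real k + 1) * (real k + 2) * u"
    using uv by (simp only:)
  then have v2: "v \<le> u"
    by (subst (asm) mult_le_cancel_left_pos) auto
  have suma: "(\<Sum>xs\<in>?L. a xs) = 2 * k * (card F * fact k * fact k)"
    unfolding a_def
    by (subst sum_multicount_gen[where k = "\<lambda>_. card F * fact k * fact k" and t = "{..<2 * k}"])
      (use card_permutations_arc[of X F k] FX assms(2,3) in auto)
  have sumb: "(\<Sum>xs\<in>?L. b xs) = 2 * k * (card G * fact (k + 2) * fact (k - 2))"
    unfolding b_def
    by (subst sum_multicount_gen[where k = "\<lambda>_. card G * fact (k + 2) * fact (k - 2)" and t = "{..<2 * k}"])
      (use card_permutations_arc[of X G "k + 2"] GX assms(2,3) in auto)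
  \<comment> \<open>There are \<open>2 * k\<close> starts and 3 offsets; the further 2 is the number
    of orders of the two points of \<open>B - K\<close>. Together they give the constant 12.\<close>
  have sume: "(\<Sum>xs\<in>?L. e xs) = 2 * k * 3 * (P * fact k * 2 * fact (k - 2))"
  proof -
    have "card {xs \<in> ?L. set (take (k + 2) (rotate i xs)) \<in> G \<and> set (take k (rotate (i + j) xs)) \<in> F}
        = P * fact k * 2 * fact (k - 2)" if "j \<le> 2" for i j
      using card_permutations_nested_arcs[of X G "k + 2" F k j i] that FX GX assms(1-3)
      by (simp add: P_def)
    then have "(\<Sum>xs\<in>?L. card {ij \<in> {..<2 * k} \<times> {..2}. set (take (k + 2) (rotate (fst ij) xs)) \<in> G
          \<and> set (take k (rotate (fst ij + snd ij) xs)) \<in> F})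
        = (\<Sum>ij\<in>{..<2 * k} \<times> {..2::nat}. P * fact k * 2 * fact (k - 2))"
      by (intro sum_multicount_gen) auto
    moreover have "e xs = card {ij \<in> {..<2 * k} \<times> {..2}. set (take (k + 2) (rotate (fst ij) xs)) \<in> G
          \<and> set (take k (rotate (fst ij + snd ij) xs)) \<in> F}" for xs
      unfolding e_def by (intro arg_cong[where f = card]) auto
    ultimately show ?thesis by simp
  qed
  have N1: "fact k * fact k * u = N"
    using binomial_fact_lemma[of k "2 * k"] unfolding u_def N_def
    by (metis add_diff_cancel_left' le_add1 mult_2 of_nat_fact of_nat_mult)
  have "fact (k + 2) * fact (2 * k - (k + 2)) * ((2 * k) choose (k + 2)) = (fact (2 * k) :: nat)"
    by (rule binomial_fact_lemma) (use assms in simp)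
  moreover have "2 * k - (k + 2) = k - 2" by simp
  ultimately have N2: "fact (k + 2) * fact (k - 2) * v = N"
    unfolding v_def N_def by (metis of_nat_fact of_nat_mult)
  have "fact (k + 2) = (real k + 1) * (real k + 2) * fact k"
    by (simp add: algebra_simps)
  then have "(real k + 1) * (real k + 2) * (fact k * fact (k - 2) * v) = N"
    unfolding N2[symmetric] by (simp only: mult.assoc)
  then have N3: "fact k * fact (k - 2) * v = N / ((real k + 1) * (real k + 2))"
    by (subst eq_divide_eq) (auto simp: mult_ac)
  have "(\<Sum>xs\<in>?L. u * a xs + v * b xs) \<le> (\<Sum>xs\<in>?L. real k * u + (real k - 2) * v + v * e xs)"
  proof (rule sum_mono)
    fix xs assume "xs \<in> ?L"
    then have "length xs = 2 * k" "distinct xs"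
      using assms(3) by (auto simp: length_finite_permutations_of_set permutations_of_setD)
    then show "u * a xs + v * b xs \<le> real k * u + (real k - 2) * v + v * e xs"
      unfolding a_def b_def e_def using circle_bound[OF \<open>k \<ge> 2\<close> _ _ int v0 v2 v1] by blast
  qed
  also have "(\<Sum>xs\<in>?L. u * a xs + v * b xs) = u * real (\<Sum>xs\<in>?L. a xs) + v * real (\<Sum>xs\<in>?L. b xs)"
    by (simp add: sum.distrib sum_distrib_left)
  also have "\<dots> = 2 * k * card F * (fact k * fact k * u) + 2 * k * card G * (fact (k + 2) * fact (k - 2) * v)"
    unfolding suma sumb by (simp add: mult_ac del: fact_Suc)
  also have "\<dots> = N * (2 * real k * (card F + card G))"
    unfolding N1 N2 by (simp add: algebra_simps)
  also have "(\<Sum>xs\<in>?L. real k * u + (real k - 2) * v + v * e xs)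
      = N * (real k * u + (real k - 2) * v) + v * real (\<Sum>xs\<in>?L. e xs)"
    using assms by (simp add: sum.distrib sum_distrib_left N_def)
  also have "v * real (\<Sum>xs\<in>?L. e xs) = 12 * k * P * (fact k * fact (k - 2) * v)"
    unfolding sume by (simp add: mult_ac)
  also have "\<dots> = N * (12 * k * P / ((real k + 1) * (real k + 2)))"
    unfolding N3 by simp
  finally have "N * (2 * real k * (card F + card G))
      \<le> N * (real k * u + (real k - 2) * v + 12 * k * P / ((real k + 1) * (real k + 2)))"
    by (simp only: distrib_left)
  moreover have "N > 0" by (simp add: N_def)
  ultimately show ?thesis
    unfolding u_def v_def P_def by (simp only: mult_le_cancel_left_pos of_nat_mult of_nat_numeral)
qed

section \<open>Temperateness and the final estimate\<close>

text \<open>For \<open>B\<close> of size \<open>k + 2\<close>, the bound \<open>card B\<close> on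
  member subsets equals the number of \<open>(k + 1)\<close>-subsets of \<open>B\<close>. Cancelling
  the \<open>(k + 1)\<close>-subsets that are members leaves at most as many
  \<open>k\<close>-subsets in the family as missing \<open>(k + 1)\<close>-subsets. The pairs of a
  missing set and a \<open>B\<close> above it are then counted from the missing set.\<close>

lemma temperate_containments_le:
  assumes "finite X" "card X = 2 * k" and "temperate \<A>"
    and \<A>: "\<A> \<subseteq> nsets X k \<union> nsets X (k + 1) \<union> nsets X (k + 2)"
  shows "(\<Sum>B\<in>\<A> \<inter> nsets X (k + 2). card {K \<in> \<A> \<inter> nsets X k. K \<subseteq> B})
       \<le> (k - 1) * card (nsets X (k + 1) - \<A>)"
proof -
  let ?F = "\<A> \<inter> nsets X k" and ?G = "\<A> \<inter> nsets X (k + 2)" and ?M = "nsets X (k + 1) - \<A>"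
  have fin: "finite (nsets X i)" for i
    by (rule finite_imp_finite_nsets[OF assms(1)])
  have fin\<A>: "finite \<A>"
    by (rule finite_subset[OF \<A>]) (simp add: fin)
  have "card {K \<in> ?F. K \<subseteq> B} \<le> card {C \<in> ?M. C \<subseteq> B}" if B: "B \<in> ?G" for B
  proof -
    let ?H = "{C \<in> \<A> \<inter> nsets X (k + 1). C \<subseteq> B}"
    have "card {K \<in> ?F. K \<subseteq> B} + card ?H = card ({K \<in> ?F. K \<subseteq> B} \<union> ?H)"
      using fin\<A> by (intro card_Un_disjoint[symmetric]) (auto simp: nsets_def)
    also have "\<dots> \<le> card {C \<in> \<A>. C \<subset> B}"
      using fin\<A> B by (intro card_mono) (auto simp: nsets_def)
    also have "\<dots> \<le> card B"
      using assms(3) B unfolding temperate_def by blast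
    also have "\<dots> = card (nsets B (k + 1))"
    proof -
      have "finite B" "card B = k + 2" using B by (auto simp: nsets_def)
      then show ?thesis by (simp add: card_nsets)
    qed
    also have "nsets B (k + 1) = ?H \<union> {C \<in> ?M. C \<subseteq> B}"
      using B by (auto simp: nsets_def)
    also have "card \<dots> \<le> card ?H + card {C \<in> ?M. C \<subseteq> B}"
      by (rule card_Un_le)
    finally show ?thesis by simp
  qed
  then have "(\<Sum>B\<in>?G. card {K \<in> ?F. K \<subseteq> B}) \<le> (\<Sum>B\<in>?G. card {C \<in> ?M. C \<subseteq> B})"
    by (rule sum_mono)
  also have "\<dots> = (\<Sum>C\<in>?M. card {B \<in> ?G. C \<subseteq> B})"
    using fin by (intro sum_multicount_gen) auto
  also have "\<dots> \<le> (\<Sum>C\<in>?M. k - 1)"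
  proof (rule sum_mono)
    fix C assume C: "C \<in> ?M"
    \<comment> \<open>A \<open>(k + 2)\<close>-set above \<open>C\<close> adds one of the
      \<open>2 * k - (k + 1)\<close> points outside \<open>C\<close>.\<close>
    have "{B \<in> ?G. C \<subseteq> B} \<subseteq> (\<lambda>x. insert x C) ` (X - C)"
    proof
      fix B assume B: "B \<in> {B \<in> ?G. C \<subseteq> B}"
      then have "card (B - C) = 1"
        using C by (subst card_Diff_subset) (auto simp: nsets_def)
      then obtain x where "B - C = {x}" by (auto simp: card_1_singleton_iff)
      then show "B \<in> (\<lambda>x. insert x C) ` (X - C)"
        using B by (auto simp: nsets_def image_iff)
    qed
    then have "card {B \<in> ?G. C \<subseteq> B} \<le> card (X - C)"
      using assms(1) by (intro surj_card_le) auto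
    also have "\<dots> = k - 1"
      using C assms(2) by (subst card_Diff_subset) (auto simp: nsets_def)
    finally show "card {B \<in> ?G. C \<subseteq> B} \<le> k - 1" .
  qed
  finally show ?thesis by (simp add: mult.commute)
qed

theorem mainTheorem2:
  fixes k :: nat and \<A> :: "nat set set"
  assumes "k \<ge> 2"
    and "\<A> \<subseteq> nsets {1..2 * k} k \<union> nsets {1..2 * k} (k + 1) \<union> nsets {1..2 * k} (k + 2)"
    and "intersecting \<A>"
    and "temperate \<A>"
  shows "real (card \<A>) \<le> 1 / 2 * real ((2 * k) choose k) + real ((2 * k) choose (k + 1))
           + real ((2 * k - 1) choose (k + 2))"
proof -
  let ?X = "{1..2 * k}"
  define F where "F = \<A> \<inter> nsets ?X k"
  define H where "H = \<A> \<inter> nsets ?X (k + 1)"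
  define G where "G = \<A> \<inter> nsets ?X (k + 2)"
  define m where "m = card (nsets ?X (k + 1) - \<A>)"
  define P where "P = (\<Sum>B\<in>G. card {K \<in> F. K \<subseteq> B})"
  have fin: "finite (nsets ?X i)" for i
    by (rule finite_imp_finite_nsets) simp
  have "\<A> = F \<union> H \<union> G"
    using assms(2) by (auto simp: F_def H_def G_def)
  then have card\<A>: "card \<A> \<le> card F + card H + card G"
    by (metis card_Un_le add_le_mono1 le_trans)
  have "card H + m = card (nsets ?X (k + 1))"
    unfolding H_def m_def using fin card_Int_Diff[of "nsets ?X (k + 1)" \<A>] by (simp add: Int_commute)
  then have cardH: "real (card H) = real ((2 * k) choose (k + 1)) - m"
    by (simp add: card_nsets flip: of_nat_add)
  have "P \<le> (k - 1) * m"
    unfolding P_def F_def G_def m_def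
    by (rule temperate_containments_le) (use assms in auto)
  then have "real P \<le> real ((k - 1) * m)" by (simp only: of_nat_le_iff)
  then have P: "real P \<le> (real k - 1) * m" using \<open>k \<ge> 2\<close> by (simp add: of_nat_diff)
  \<comment> \<open>Absorption produces the factor \<open>2 * k\<close>, whose cancellation leaves
    the last binomial of the theorem.\<close>
  have "(2 * k - (k + 2)) * ((2 * k) choose (k + 2)) = 2 * k * ((2 * k - 1) choose (k + 2))"
    by (rule binomial_absorb_comp)
  then have "real ((2 * k - (k + 2)) * ((2 * k) choose (k + 2))) = real (2 * k * ((2 * k - 1) choose (k + 2)))"
    by (simp only:)
  then have w: "(real k - 2) * ((2 * k) choose (k + 2)) = 2 * real k * ((2 * k - 1) choose (k + 2))"
    using \<open>k \<ge> 2\<close> by (simp add: of_nat_diff)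
  have "2 * real k * (card F + card G)
      \<le> real k * ((2 * k) choose k) + (real k - 2) * ((2 * k) choose (k + 2))
        + 12 * real k * P / ((real k + 1) * (real k + 2))"
    unfolding P_def
  proof (rule two_layer_bound[where X = ?X])
    show "A \<inter> B \<noteq> {}" if "A \<in> F" "B \<in> F" for A B
      using that assms(3) by (auto simp: F_def intersecting_def)
  qed (use \<open>k \<ge> 2\<close> in \<open>auto simp: F_def G_def\<close>)
  also have "12 * real k * P / ((real k + 1) * (real k + 2)) \<le> 2 * real k * m"
  proof -
    \<comment> \<open>The difference of the two sides is k^2 - 3k + 8 = ((2k - 3)^2 + 23) /
      4.\<close>
    have "6 * (real k - 1) \<le> (real k + 1) * (real k + 2)"
      using zero_le_power2[of "2 * real k - 3"] by (simp add: power2_eq_square algebra_simps)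
    then have "6 * (real k - 1) * m \<le> (real k + 1) * (real k + 2) * m"
      by (rule mult_right_mono) simp
    then have "6 * real P \<le> (real k + 1) * (real k + 2) * m" using P by linarith
    then have "2 * real k * (6 * real P) \<le> 2 * real k * ((real k + 1) * (real k + 2) * m)"
      by (rule mult_left_mono) simp
    moreover have "0 < (real k + 1) * (real k + 2)" by simp
    ultimately show ?thesis by (simp add: pos_divide_le_eq mult_ac)
  qed
  finally have "2 * real k * (card F + card G)
      \<le> 2 * real k * (1 / 2 * ((2 * k) choose k) + ((2 * k - 1) choose (k + 2)) + m)"
    unfolding w by (simp add: algebra_simps)
  then have "real (card F + card G) \<le> 1 / 2 * ((2 * k) choose k) + ((2 * k - 1) choose (k + 2)) + m"
    using \<open>k \<ge> 2\<close> by (subst (asm) mult_le_cancel_left_pos) auto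
  \<comment> \<open>The excess \<open>m\<close> is offset by the \<open>m\<close> sets absent from
    the middle layer.\<close>
  then show ?thesis using card\<A> cardH by linarith
qed

end
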